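(* The only rotational surfaces (with axis of revolution the $z$-axis) whose principal curvatures satisfy $k_{\mathrm m}^2-2k_{\mathrm p}\,k_{\mathrm m}+\mu=0$ for a constant $\mu\neq0$ are the sphere of radius $R=1/\sqrt{\mu}$ (when $\mu>0$) and the elasticoids with nonzero modulus. That is: (i) if $S_\alpha$ is a rotational surface satisfying $k_{\mathrm m}^2-2k_{\mathrm p}k_{\mathrm m}+\mu=0$ at every point for some real constant $\mu\neq0$, then, up to a translation along the $z$-axis, $S_\alpha$ is an open piece of the sphere of radius $1/\sqrt{\mu}$ centred at the origin (which can occur only if $\mu>0$) or of an elasticoid with nonzero modulus; (ii) conversely, for $\mu>0$ the sphere of radius $1/\sqrt\mu$ centred on the axis satisfies this relation, and every elasticoid with nonzero modulus satisfies such a relation for some constant $\mu\neq0$.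
   Context: Rotational surfaces: let $\alpha(s)=(x(s),z(s))$, $s\in I$ ($I\subseteq\mathbb{R}$ an open interval), be a smooth ($C^\infty$) curve in the $xz$-plane parametrized by arc length ($\dot x^2+\dot z^2=1$) with $x>0$. The rotational surface $S_\alpha\subset\mathbb{R}^3$ with generatrix $\alpha$ is the surface generated by rotating $\alpha$ around the $z$-axis, parametrized by $X(s,\theta)=(x(s)\cos\theta,\,x(s)\sin\theta,\,z(s))$. The principal curvatures of $S_\alpha$ (along meridians and parallels respectively) are $k_{\mathrm m}=\kappa$ and $k_{\mathrm p}=\dot z/x$, where $\kappa=\dot x\ddot z-\dot z\ddot x$ is the signed curvature of $\alpha$. (Reversing the orientation of $\alpha$ changes the sign of both.) Relations between principal curvatures are understood at points off the axis. Elasticoids: an elastic curve with directrix the $z$-axis is a curve $\alpha=(x,z)$ in the $xz$-plane whose curvature is proportional to the signed distance to the $z$-axis, $\kappa=2ax$, $a>0$ (after choosing the orientation of $\alpha$ suitably). Along such a unit-speed curve $\dot z=a x^2-k$ for a constant $k$, necessarily $k>-1$; $k$ is called the modulus. An elasticoid of modulus $k$ is a rotational surface generated by rotating such an elastic curve around its directrix (the $z$-axis). *)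

theory Defs
  imports "HOL-Analysis.Analysis"
begin

text \<open>A curve in the xz-plane is given by its two coordinate functions on an open interval.\<close>

definition smooth_on :: "real set \<Rightarrow> (real \<Rightarrow> real) \<Rightarrow> bool" where
  "smooth_on I f \<longleftrightarrow> (\<forall>n. (deriv ^^ n) f differentiable_on I)"

definition arclength_curve :: "real set \<Rightarrow> (real \<Rightarrow> real) \<Rightarrow> (real \<Rightarrow> real) \<Rightarrow> bool" where
  "arclength_curve I x z \<longleftrightarrow>
     open I \<and> is_interval I \<and> I \<noteq> {} \<and> smooth_on I x \<and> smooth_on I z \<and>
     (\<forall>s\<in>I. (deriv x s)\<^sup>2 + (deriv z s)\<^sup>2 = 1)"

definition generatrix :: "real set \<Rightarrow> (real \<Rightarrow> real) \<Rightarrow> (real \<Rightarrow> real) \<Rightarrow> bool" where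
  "generatrix I x z \<longleftrightarrow> arclength_curve I x z \<and> (\<forall>s\<in>I. x s > 0)"

definition rot_param :: "(real \<Rightarrow> real) \<Rightarrow> (real \<Rightarrow> real) \<Rightarrow> real \<Rightarrow> real \<Rightarrow> real^3" where
  "rot_param x z s \<theta> = vector [x s * cos \<theta>, x s * sin \<theta>, z s]"

definition rot_surface :: "real set \<Rightarrow> (real \<Rightarrow> real) \<Rightarrow> (real \<Rightarrow> real) \<Rightarrow> (real^3) set" where
  "rot_surface I x z = {rot_param x z s \<theta> | s \<theta>. s \<in> I}"

definition z_axis :: "(real^3) set" where
  "z_axis = range (\<lambda>c. vector [0, 0, c])"

definition curvature :: "(real \<Rightarrow> real) \<Rightarrow> (real \<Rightarrow> real) \<Rightarrow> real \<Rightarrow> real" where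
  "curvature x z s = deriv x s * deriv (deriv z) s - deriv z s * deriv (deriv x) s"

text \<open>The principal curvatures along meridians and parallels are taken with respect to the unit
  normal \<open>rot_normal\<close>; the lemmas \<open>meridian_curvature_principal\<close> and
  \<open>parallel_curvature_principal\<close> below say that the coordinate directions of \<open>rot_param\<close> are
  eigenvectors of the shape operator (minus the differential of the normal) with these
  eigenvalues.\<close>

definition meridian_curvature :: "(real \<Rightarrow> real) \<Rightarrow> (real \<Rightarrow> real) \<Rightarrow> real \<Rightarrow> real" where
  "meridian_curvature x z s = curvature x z s"

definition parallel_curvature :: "(real \<Rightarrow> real) \<Rightarrow> (real \<Rightarrow> real) \<Rightarrow> real \<Rightarrow> real" where
  "parallel_curvature x z s = deriv z s / x s"

definition rot_normal :: "(real \<Rightarrow> real) \<Rightarrow> (real \<Rightarrow> real) \<Rightarrow> real \<Rightarrow> real \<Rightarrow> real^3" where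
  "rot_normal x z s \<theta> = vector [- deriv z s * cos \<theta>, - deriv z s * sin \<theta>, deriv x s]"

lemma has_vector_derivative_vector3:
  fixes f g h :: "real \<Rightarrow> real"
  assumes "(f has_real_derivative f') (at t)" "(g has_real_derivative g') (at t)"
    "(h has_real_derivative h') (at t)"
  shows "((\<lambda>t. vector [f t, g t, h t] :: real^3) has_vector_derivative vector [f', g', h']) (at t)"
proof -
  have eq: "vector [a, b, c] = a *\<^sub>R axis 1 1 + b *\<^sub>R axis 2 1 + c *\<^sub>R (axis 3 1 :: real^3)"
    for a b c :: real
    by (simp add: vec_eq_iff forall_3 axis_def)
  show ?thesis
    unfolding eq using assms
    by (auto intro!: derivative_eq_intros simp: has_real_derivative_iff_has_vector_derivative)
qed

lemma arclength_curve_derivs: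
  assumes "arclength_curve I x z" "s \<in> I"
  shows "(x has_real_derivative deriv x s) (at s)"
    and "(z has_real_derivative deriv z s) (at s)"
    and "(deriv x has_real_derivative deriv (deriv x) s) (at s)"
    and "(deriv z has_real_derivative deriv (deriv z) s) (at s)"
    and "(deriv x s)\<^sup>2 + (deriv z s)\<^sup>2 = 1"
    and "deriv x s * deriv (deriv x) s + deriv z s * deriv (deriv z) s = 0"
proof -
  have d: "(f has_real_derivative deriv f s) (at s)" if "f differentiable_on I" for f :: "real \<Rightarrow> real"
    using that assms unfolding arclength_curve_def
    by (metis DERIV_deriv_iff_real_differentiable differentiable_on_eq_differentiable_at)
  have sm: "(deriv ^^ n) x differentiable_on I" "(deriv ^^ n) z differentiable_on I" for n
    using assms unfolding arclength_curve_def smooth_on_def by auto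
  show 1: "(x has_real_derivative deriv x s) (at s)" "(z has_real_derivative deriv z s) (at s)"
    using d sm[of 0] by auto
  show 2: "(deriv x has_real_derivative deriv (deriv x) s) (at s)"
    "(deriv z has_real_derivative deriv (deriv z) s) (at s)"
    using d sm[of 1] by auto
  show "(deriv x s)\<^sup>2 + (deriv z s)\<^sup>2 = 1"
    using assms unfolding arclength_curve_def by auto
  have "((\<lambda>s. (deriv x s)\<^sup>2 + (deriv z s)\<^sup>2) has_real_derivative
      2 * (deriv x s * deriv (deriv x) s + deriv z s * deriv (deriv z) s)) (at s)"
    by (rule derivative_eq_intros 2 refl | simp)+
  moreover have "((\<lambda>s. (deriv x s)\<^sup>2 + (deriv z s)\<^sup>2) has_real_derivative 0) (at s)"
    by (rule has_field_derivative_transform_within_open[of "\<lambda>_. 1" _ _ I])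
      (use assms in \<open>auto simp: arclength_curve_def\<close>)
  ultimately show "deriv x s * deriv (deriv x) s + deriv z s * deriv (deriv z) s = 0"
    using DERIV_unique by fastforce
qed

lemma rot_param_derivs:
  assumes "arclength_curve I x z" "s \<in> I"
  shows "((\<lambda>s. rot_param x z s \<theta>) has_vector_derivative
      vector [deriv x s * cos \<theta>, deriv x s * sin \<theta>, deriv z s]) (at s)"
    and "((\<lambda>\<theta>. rot_param x z s \<theta>) has_vector_derivative
      vector [- x s * sin \<theta>, x s * cos \<theta>, 0]) (at \<theta>)"
  unfolding rot_param_def
  by (rule has_vector_derivative_vector3;
      (rule derivative_eq_intros arclength_curve_derivs[OF assms] refl | simp)+)+

lemma rot_normal_unit:
  assumes "arclength_curve I x z" "s \<in> I"
  shows "norm (rot_normal x z s \<theta>) = 1"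
    and "rot_normal x z s \<theta> \<bullet> vector_derivative (\<lambda>s. rot_param x z s \<theta>) (at s) = 0"
    and "rot_normal x z s \<theta> \<bullet> vector_derivative (\<lambda>\<theta>. rot_param x z s \<theta>) (at \<theta>) = 0"
proof -
  have "(deriv z s * cos \<theta>)\<^sup>2 + (deriv z s * sin \<theta>)\<^sup>2 + (deriv x s)\<^sup>2
      = (deriv z s)\<^sup>2 * ((cos \<theta>)\<^sup>2 + (sin \<theta>)\<^sup>2) + (deriv x s)\<^sup>2"
    by algebra
  also have "\<dots> = 1"
    using arclength_curve_derivs(5)[OF assms] by simp
  finally show "norm (rot_normal x z s \<theta>) = 1"
    by (simp add: rot_normal_def norm_eq_1 inner_vec_def sum_3 power2_eq_square)
  have "deriv z s * cos \<theta> * (deriv x s * cos \<theta>) + deriv z s * sin \<theta> * (deriv x s * sin \<theta>)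
      = deriv x s * deriv z s * ((cos \<theta>)\<^sup>2 + (sin \<theta>)\<^sup>2)"
    by algebra
  then show "rot_normal x z s \<theta> \<bullet> vector_derivative (\<lambda>s. rot_param x z s \<theta>) (at s) = 0"
    by (simp add: vector_derivative_at[OF rot_param_derivs(1)[OF assms]] rot_normal_def
        inner_vec_def sum_3)
  show "rot_normal x z s \<theta> \<bullet> vector_derivative (\<lambda>\<theta>. rot_param x z s \<theta>) (at \<theta>) = 0"
    by (simp add: vector_derivative_at[OF rot_param_derivs(2)[OF assms]] rot_normal_def
        inner_vec_def sum_3)
qed

lemma meridian_curvature_principal:
  assumes "arclength_curve I x z" "s \<in> I"
  shows "((\<lambda>s. rot_normal x z s \<theta>) has_vector_derivative
    - meridian_curvature x z s *\<^sub>R vector_derivative (\<lambda>s. rot_param x z s \<theta>) (at s)) (at s)"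
proof -
  note D = arclength_curve_derivs[OF assms]
  have z2: "deriv (deriv z) s = curvature x z s * deriv x s"
    using D(5,6) unfolding curvature_def by algebra
  have x2: "deriv (deriv x) s = - curvature x z s * deriv z s"
    using D(5,6) unfolding curvature_def by algebra
  have "((\<lambda>s. rot_normal x z s \<theta>) has_vector_derivative vector
      [- deriv (deriv z) s * cos \<theta>, - deriv (deriv z) s * sin \<theta>, deriv (deriv x) s]) (at s)"
    unfolding rot_normal_def
    by (rule has_vector_derivative_vector3; (rule derivative_eq_intros D refl | simp)+)
  moreover have "vector
      [- deriv (deriv z) s * cos \<theta>, - deriv (deriv z) s * sin \<theta>, deriv (deriv x) s]
    = - meridian_curvature x z s *\<^sub>R vector_derivative (\<lambda>s. rot_param x z s \<theta>) (at s)"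
    unfolding vector_derivative_at[OF rot_param_derivs(1)[OF assms]] meridian_curvature_def z2 x2
    by (simp add: vec_eq_iff forall_3)
  ultimately show ?thesis by simp
qed

lemma parallel_curvature_principal:
  assumes "arclength_curve I x z" "s \<in> I" "x s \<noteq> 0"
  shows "((\<lambda>\<theta>. rot_normal x z s \<theta>) has_vector_derivative
    - parallel_curvature x z s *\<^sub>R vector_derivative (\<lambda>\<theta>. rot_param x z s \<theta>) (at \<theta>)) (at \<theta>)"
proof -
  have "((\<lambda>\<theta>. rot_normal x z s \<theta>) has_vector_derivative
      vector [deriv z s * sin \<theta>, - deriv z s * cos \<theta>, 0]) (at \<theta>)"
    unfolding rot_normal_def
    by (rule has_vector_derivative_vector3; (rule derivative_eq_intros refl | simp)+)
  moreover have "vector [deriv z s * sin \<theta>, - deriv z s * cos \<theta>, 0]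
    = - parallel_curvature x z s *\<^sub>R vector_derivative (\<lambda>\<theta>. rot_param x z s \<theta>) (at \<theta>)"
    unfolding vector_derivative_at[OF rot_param_derivs(2)[OF assms(1,2)]] parallel_curvature_def
    using assms(3) by (simp add: vec_eq_iff forall_3)
  ultimately show ?thesis by simp
qed

text \<open>The relation between the principal curvatures, imposed off the axis only. Both curvatures
  change sign with the orientation, so it does not depend on the orientation.\<close>

definition curvature_relation ::
    "real \<Rightarrow> real set \<Rightarrow> (real \<Rightarrow> real) \<Rightarrow> (real \<Rightarrow> real) \<Rightarrow> bool" where
  "curvature_relation \<mu> I x z \<longleftrightarrow>
     (\<forall>s\<in>I. x s \<noteq> 0 \<longrightarrow>
        (meridian_curvature x z s)\<^sup>2
          - 2 * parallel_curvature x z s * meridian_curvature x z s + \<mu> = 0)"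

text \<open>Elastic curves of modulus \<open>k\<close> with directrix the z-axis. The sign \<open>\<epsilon>\<close> is the choice of
  orientation: reversing the curve changes the sign of both the curvature and the derivative of
  \<open>z\<close>. The distance \<open>x\<close> to the axis is signed, so the curve may cross the axis. The axis itself
  solves the equation (with \<open>k\<close> equal to 1 or -1) and is excluded.\<close>

definition elastic_curve ::
    "real \<Rightarrow> real set \<Rightarrow> (real \<Rightarrow> real) \<Rightarrow> (real \<Rightarrow> real) \<Rightarrow> bool" where
  "elastic_curve k I x z \<longleftrightarrow>
     arclength_curve I x z \<and> (\<exists>s\<in>I. x s \<noteq> 0) \<and>
     (\<exists>a>0. \<exists>\<epsilon>\<in>{1, -1}. \<forall>s\<in>I.
        \<epsilon> * curvature x z s = 2 * a * x s \<and> \<epsilon> * deriv z s = a * (x s)\<^sup>2 - k)"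

definition elasticoid :: "real \<Rightarrow> (real^3) set \<Rightarrow> bool" where
  "elasticoid k E \<longleftrightarrow> (\<exists>I x z. elastic_curve k I x z \<and> E = rot_surface I x z)"

definition open_piece :: "(real^3) set \<Rightarrow> (real^3) set \<Rightarrow> bool" where
  "open_piece S T \<longleftrightarrow> S \<noteq> {} \<and> openin (top_of_set T) S"

end

theory Submission
  imports Defs
begin

text \<open>
  Write \<open>\<kappa>\<close> for the curvature of the generatrix. Multiplied by \<open>x\<close>, the relation
  reads \<open>x * \<kappa>\<^sup>2 - 2 * z' * \<kappa> + \<mu> * x = 0\<close>. Differentiating it, inserting the Frenet equations
  \<open>x'' = - \<kappa> * z'\<close> and \<open>z'' = \<kappa> * x'\<close>, and eliminating \<open>\<mu>\<close> gives \<open>U * V = 0\<close> for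
  \<open>U = x * \<kappa> - z'\<close> and \<open>V = x * \<kappa>' - \<kappa> * x'\<close>. So the interval is covered by two closed sets.
  Where \<open>U\<close> vanishes the surface is umbilic, which leads to a sphere; where \<open>V\<close> vanishes,
  \<open>\<kappa> / x\<close> is stationary, which leads to an elastic curve.

  The two behaviours cannot alternate along one curve
  (\<open>umbilic_or_curvature_proportional\<close>), and this uses more than the relation itself: the
  unit-speed circle and the elastic curve with \<open>\<kappa> = \<mu> * x\<close> that touches it at its equator fit
  together there up to equal \<open>\<kappa>\<close> and \<open>\<kappa>'\<close>, and only \<open>\<kappa>''\<close> tells them apart. The set to look at is
  the relative closure of \<open>{V \<noteq> 0}\<close>. By continuity \<open>U = \<kappa>' = \<kappa>'' = 0\<close> on it, hence \<open>V = - \<kappa> * x'\<close>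
  and \<open>V' = \<kappa>\<^sup>2 * z'\<close>. Since \<open>\<mu> \<noteq> 0\<close> forces \<open>\<kappa> \<noteq> 0\<close> and the curve has unit speed, \<open>V\<close> and \<open>V'\<close>
  do not vanish together; so \<open>V\<close> has no other zeros close by, and the closure is also open.
  By connectedness it is empty or everything.

  If \<open>\<kappa> = 2 * A * x\<close>, then \<open>z' - A * x\<^sup>2\<close> is a constant \<open>- m\<close>, and the relation becomes
  \<open>\<mu> = - 4 * A * m\<close>, so that \<open>m \<noteq> 0\<close> and the surface is itself an elasticoid; the same
  computation read backwards gives the converse. If the surface is umbilic, then \<open>\<kappa>\<close> is a constant
  \<open>K\<close> with \<open>\<mu> = K\<^sup>2\<close> and \<open>x' + K * z\<close> is constant, so the curve lies on a circle centred on the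
  axis; its height is strictly monotone, so it sweeps out an open zone of the sphere.
\<close>

section \<open>Derivatives of smooth generatrices\<close>

lemma smooth_on_has_derivative:
  assumes "open I" "smooth_on I f" "s \<in> I"
  shows "((deriv ^^ n) f has_real_derivative (deriv ^^ Suc n) f s) (at s)"
  using assms unfolding smooth_on_def
  by (simp add: DERIV_deriv_iff_real_differentiable differentiable_on_eq_differentiable_at)

lemma curvature_twice_differentiable:
  assumes "arclength_curve I x z"
  obtains \<kappa>1 \<kappa>2 where
    "\<And>s. s \<in> I \<Longrightarrow> (curvature x z has_real_derivative \<kappa>1 s) (at s)"
    "\<And>s. s \<in> I \<Longrightarrow> (\<kappa>1 has_real_derivative \<kappa>2 s) (at s)"
    "continuous_on I \<kappa>2"
proof -
  define X where "X n = (deriv ^^ n) x" for n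
  define Z where "Z n = (deriv ^^ n) z" for n
  have D: "(X n has_real_derivative X (Suc n) s) (at s)"
    "(Z n has_real_derivative Z (Suc n) s) (at s)" if "s \<in> I" for n s
    using smooth_on_has_derivative[of I] that assms
    unfolding X_def Z_def arclength_curve_def by blast+
  have C: "continuous_on I (X n)" "continuous_on I (Z n)" for n
    using D DERIV_isCont continuous_at_imp_continuous_on by metis+
  have \<kappa>: "curvature x z = (\<lambda>s. X 1 s * Z 2 s - Z 1 s * X 2 s)"
    by (simp add: fun_eq_iff curvature_def X_def Z_def numeral_2_eq_2)
  show thesis
  proof
    show "(curvature x z has_real_derivative X 1 s * Z 3 s - Z 1 s * X 3 s) (at s)"
      if "s \<in> I" for s
      unfolding \<kappa> using D[OF that, of 1] D[OF that, of 2]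
      by (auto intro!: derivative_eq_intros simp: numeral_eq_Suc)
    show "((\<lambda>s. X 1 s * Z 3 s - Z 1 s * X 3 s) has_real_derivative
        X 1 s * Z 4 s + X 2 s * Z 3 s - Z 1 s * X 4 s - Z 2 s * X 3 s) (at s)"
      if "s \<in> I" for s
      using D[OF that, of 1] D[OF that, of 3]
      by (auto intro!: derivative_eq_intros simp: numeral_eq_Suc)
    show "continuous_on I
        (\<lambda>s. X 1 s * Z 4 s + X 2 s * Z 3 s - Z 1 s * X 4 s - Z 2 s * X 3 s)"
      by (intro continuous_intros C)
  qed
qed

lemma frenet_equations:
  assumes "arclength_curve I x z" "s \<in> I"
  shows "deriv (deriv x) s = - curvature x z s * deriv z s"
    and "deriv (deriv z) s = curvature x z s * deriv x s"
  using arclength_curve_derivs(5,6)[OF assms] unfolding curvature_def by algebra+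

section \<open>Zero sets on the real line\<close>

text \<open>A zero at which the derivative does not vanish is isolated. This is what turns the
  nonvanishing of \<open>V\<close> or \<open>V'\<close> into an open set of parameters in the proof of the dichotomy.\<close>

lemma eventually_nonzero_of_derivative:
  fixes f :: "real \<Rightarrow> real"
  assumes "(f has_real_derivative d) (at s)" "f s \<noteq> 0 \<or> d \<noteq> 0"
  shows "\<forall>\<^sub>F t in at s. f t \<noteq> 0"
proof (cases "f s = 0")
  case True
  have "((\<lambda>t. (f t - f s) / (t - s)) \<longlongrightarrow> d) (at s)"
    using assms(1) by (simp add: has_field_derivative_iff)
  then have "\<forall>\<^sub>F t in at s. (f t - f s) / (t - s) \<noteq> 0"
    using assms(2) True tendsto_imp_eventually_ne by blast
  then show ?thesis
    by (rule eventually_mono) (use True in auto)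
next
  case False
  have "(f \<longlongrightarrow> f s) (at s)"
    using DERIV_isCont[OF assms(1)] by (simp add: isCont_def)
  then show ?thesis
    using False tendsto_imp_eventually_ne by blast
qed

lemma derivative_zero_on_open:
  fixes f :: "real \<Rightarrow> real"
  assumes "(f has_real_derivative d) (at s)" "open A" "s \<in> A" "\<And>t. t \<in> A \<Longrightarrow> f t = 0"
  shows "d = 0"
proof -
  have "(f has_real_derivative 0) (at s)"
    by (rule has_field_derivative_transform_within_open[of "\<lambda>_. 0" _ _ A]) (use assms in auto)
  then show ?thesis
    using assms(1) DERIV_unique by blast
qed

lemma zero_on_relative_closure:
  fixes f :: "real \<Rightarrow> real"
  assumes "continuous_on I f" "A \<subseteq> I" "\<And>t. t \<in> A \<Longrightarrow> f t = 0" "s \<in> I" "s \<in> closure A"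
  shows "f s = 0"
proof -
  obtain X where X: "\<And>n. X n \<in> A" "X \<longlonglongrightarrow> s"
    using assms(5) closure_sequential by blast
  have "(\<lambda>n. f (X n)) \<longlonglongrightarrow> f s"
    using continuous_on_tendsto_compose[OF assms(1) X(2) assms(4)] X(1) assms(2)
    by (auto intro: always_eventually)
  then show ?thesis
    using assms(3)[OF X(1)] by (simp add: LIMSEQ_const_iff)
qed

lemma constant_on_interval:
  fixes f :: "real \<Rightarrow> real"
  assumes "is_interval I" "\<And>s. s \<in> I \<Longrightarrow> (f has_real_derivative 0) (at s)"
  obtains c where "\<And>s. s \<in> I \<Longrightarrow> f s = c"
  using has_field_derivative_zero_constant[of I f] assms
  by (metis has_field_derivative_at_within is_interval_convex_1)

section \<open>The dichotomy\<close>

lemma curvature_relation_cleared: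
  assumes "generatrix I x z" "curvature_relation \<mu> I x z" "s \<in> I"
  shows "x s * (curvature x z s)\<^sup>2 - 2 * deriv z s * curvature x z s + \<mu> * x s = 0"
proof -
  have "x s > 0"
    using assms unfolding generatrix_def by auto
  then have "(curvature x z s)\<^sup>2 - 2 * (deriv z s / x s) * curvature x z s + \<mu> = 0"
    using assms unfolding curvature_relation_def meridian_curvature_def parallel_curvature_def
    by force
  then have "x s * ((curvature x z s)\<^sup>2 - 2 * (deriv z s / x s) * curvature x z s + \<mu>) = 0"
    by simp
  then show ?thesis
    using \<open>x s > 0\<close> by (simp add: algebra_simps)
qed

text \<open>The two alternatives are \<open>U = 0\<close> and \<open>V = 0\<close> on the whole interval; the constancy of the
  curvature in the first one comes from \<open>U' = x * \<kappa>'\<close>. That a single alternative holds everywhere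
  rests on the clopen set \<open>Z\<close> below.\<close>

lemma umbilic_or_curvature_proportional:
  assumes gen: "generatrix I x z" and rel: "curvature_relation \<mu> I x z" and "\<mu> \<noteq> 0"
  shows "(\<forall>s\<in>I. x s * curvature x z s = deriv z s \<and>
            (curvature x z has_real_derivative 0) (at s)) \<or>
         (\<forall>s\<in>I. ((\<lambda>s. curvature x z s / x s) has_real_derivative 0) (at s))"
proof -
  define \<kappa> where "\<kappa> = curvature x z"
  have arc: "arclength_curve I x z" and pos: "\<And>s. s \<in> I \<Longrightarrow> x s > 0"
    using gen unfolding generatrix_def by auto
  have I: "open I" "connected I"
    using arc unfolding arclength_curve_def is_interval_connected_1 by auto
  obtain \<kappa>1 \<kappa>2 where
    \<kappa>1: "\<And>s. s \<in> I \<Longrightarrow> (\<kappa> has_real_derivative \<kappa>1 s) (at s)" and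
    \<kappa>2: "\<And>s. s \<in> I \<Longrightarrow> (\<kappa>1 has_real_derivative \<kappa>2 s) (at s)" and
    \<kappa>2_cont: "continuous_on I \<kappa>2"
    using curvature_twice_differentiable[OF arc] unfolding \<kappa>_def by metis
  note D = arclength_curve_derivs[OF arc]
  note frenet = frenet_equations[OF arc, folded \<kappa>_def]
  have R: "x s * (\<kappa> s)\<^sup>2 - 2 * deriv z s * \<kappa> s + \<mu> * x s = 0" if "s \<in> I" for s
    using curvature_relation_cleared[OF gen rel that] by (simp add: \<kappa>_def)
  have \<kappa>_nonzero: "\<kappa> s \<noteq> 0" if "s \<in> I" for s
    using R[OF that] pos[OF that] \<open>\<mu> \<noteq> 0\<close> by auto
  define U where "U s = x s * \<kappa> s - deriv z s" for s
  define V where "V s = x s * \<kappa>1 s - \<kappa> s * deriv x s" for s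
  have U': "(U has_real_derivative x s * \<kappa>1 s) (at s)" if "s \<in> I" for s
    unfolding U_def using D(1,4)[OF that] \<kappa>1[OF that] frenet(2)[OF that]
    by (auto intro!: derivative_eq_intros)
  have V': "(V has_real_derivative x s * \<kappa>2 s + (\<kappa> s)\<^sup>2 * deriv z s) (at s)" if "s \<in> I" for s
    unfolding V_def using D(1,3)[OF that] \<kappa>1[OF that] \<kappa>2[OF that] frenet(1)[OF that]
    by (auto intro!: derivative_eq_intros simp: power2_eq_square algebra_simps)
  \<comment> \<open>This is the differentiated relation; the relation itself serves to eliminate \<open>\<mu>\<close>.\<close>
  have UV: "U s * V s = 0" if "s \<in> I" for s
  proof -
    have "((\<lambda>s. x s * (\<kappa> s)\<^sup>2 - 2 * deriv z s * \<kappa> s + \<mu> * x s) has_real_derivative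
        deriv x s * (\<kappa> s)\<^sup>2 + x s * (2 * \<kappa> s * \<kappa>1 s)
          - 2 * (\<kappa> s * deriv x s * \<kappa> s + deriv z s * \<kappa>1 s) + \<mu> * deriv x s) (at s)"
      using D(1,4)[OF that] \<kappa>1[OF that] frenet(2)[OF that]
      by (auto intro!: derivative_eq_intros simp: power2_eq_square algebra_simps)
    then have "deriv x s * (\<kappa> s)\<^sup>2 + x s * (2 * \<kappa> s * \<kappa>1 s)
          - 2 * (\<kappa> s * deriv x s * \<kappa> s + deriv z s * \<kappa>1 s) + \<mu> * deriv x s = 0"
      by (rule derivative_zero_on_open[OF _ I(1) that R])
    then have "x s * (2 * (U s * V s)) = 0"
      using R[OF that]
      unfolding U_def V_def by algebra
    then show ?thesis
      using pos[OF that] by simp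
  qed
  define A where "A = {s \<in> I. V s \<noteq> 0}"
  define Z where "Z = I \<inter> closure A"
  have "A \<subseteq> I"
    by (auto simp: A_def)
  have "continuous_on I V"
    using V' DERIV_isCont continuous_at_imp_continuous_on by blast
  then have "open A"
    using continuous_open_preimage[OF \<open>continuous_on I V\<close> I(1), of "- {0}"]
    by (auto simp: A_def vimage_def Int_def)
  have U_A: "U s = 0" if "s \<in> A" for s
    using UV that by (auto simp: A_def)
  \<comment> \<open>As \<open>U\<close> vanishes identically on the open set \<open>A\<close>, so do \<open>U' = x * \<kappa>'\<close> and then \<open>\<kappa>''\<close>.\<close>
  have \<kappa>1_A: "\<kappa>1 s = 0" if "s \<in> A" for s
  proof -
    have "x s * \<kappa>1 s = 0"
      by (rule derivative_zero_on_open[OF U' \<open>open A\<close> that]) (use that \<open>A \<subseteq> I\<close> U_A in auto)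
    then show ?thesis
      using pos that \<open>A \<subseteq> I\<close> by fastforce
  qed
  have \<kappa>2_A: "\<kappa>2 s = 0" if "s \<in> A" for s
    by (rule derivative_zero_on_open[OF \<kappa>2 \<open>open A\<close> that]) (use that \<open>A \<subseteq> I\<close> \<kappa>1_A in auto)
  have "continuous_on I U" "continuous_on I \<kappa>1"
    using U' \<kappa>2 DERIV_isCont continuous_at_imp_continuous_on by blast+
  then have on_Z: "U s = 0" "\<kappa>1 s = 0" "\<kappa>2 s = 0" if "s \<in> Z" for s
    using zero_on_relative_closure[OF _ \<open>A \<subseteq> I\<close>] that U_A \<kappa>1_A \<kappa>2_A \<kappa>2_cont
    unfolding Z_def by blast+
  \<comment> \<open>At a point of \<open>Z\<close>, \<open>V\<close> and \<open>V'\<close> cannot both vanish, so a punctured neighbourhood lies in \<open>A\<close>.\<close>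
  have "\<exists>e>0. ball s e \<subseteq> Z" if "s \<in> Z" for s
  proof -
    have s: "s \<in> I"
      using that by (simp add: Z_def)
    have "V s = - \<kappa> s * deriv x s" "x s * \<kappa>2 s + (\<kappa> s)\<^sup>2 * deriv z s = (\<kappa> s)\<^sup>2 * deriv z s"
      using on_Z[OF that] by (simp_all add: V_def)
    moreover have "deriv x s \<noteq> 0 \<or> deriv z s \<noteq> 0"
      using D(5)[OF s] by auto
    ultimately have "\<forall>\<^sub>F t in at s. V t \<noteq> 0"
      by (intro eventually_nonzero_of_derivative[OF V'[OF s]]) (use \<kappa>_nonzero[OF s] in auto)
    moreover have "\<forall>\<^sub>F t in at s. t \<in> I"
      using I(1) s by (rule eventually_at_in_open')
    ultimately have "\<forall>\<^sub>F t in at s. t \<in> A"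
      by eventually_elim (simp add: A_def)
    then obtain e where "e > 0" "\<And>t. t \<noteq> s \<Longrightarrow> dist t s < e \<Longrightarrow> t \<in> A"
      unfolding eventually_at by auto
    then have "ball s e \<subseteq> Z"
      using that \<open>A \<subseteq> I\<close> closure_subset[of A]
      by (metis (no_types, lifting) Int_iff Z_def dist_commute mem_ball subset_iff)
    then show ?thesis
      using \<open>e > 0\<close> by blast
  qed
  then have "open Z"
    unfolding open_contains_ball by blast
  then have "openin (top_of_set I) Z" "closedin (top_of_set I) Z"
    using I(1) by (auto simp: Z_def openin_open_eq closedin_closed)
  then consider "Z = {}" | "Z = I"
    using I(2) connected_clopen by blast
  then show ?thesis
  proof cases
    case 1
    have "((\<lambda>s. \<kappa> s / x s) has_real_derivative 0) (at s)" if "s \<in> I" for s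
    proof -
      have "V s = 0"
        using 1 that closure_subset[of A] unfolding Z_def A_def by auto
      then show ?thesis
        using D(1)[OF that] \<kappa>1[OF that] pos[OF that] unfolding V_def
        by (auto intro!: derivative_eq_intros simp: algebra_simps)
    qed
    then show ?thesis
      by (simp add: \<kappa>_def)
  next
    case 2
    then have "x s * \<kappa> s = deriv z s \<and> (\<kappa> has_real_derivative 0) (at s)" if "s \<in> I" for s
      using on_Z(1,2)[of s] \<kappa>1[OF that] that by (simp add: U_def)
    then show ?thesis
      unfolding \<kappa>_def by blast
  qed
qed

section \<open>The two families\<close>

text \<open>The curvature is \<open>2 * A * x\<close> for a constant \<open>A\<close> of either sign, whereas an elastic curve has
  a positive factor \<open>a\<close>. The sign of \<open>A\<close> is absorbed by the orientation, so \<open>a = \<bar>A\<bar>\<close> and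
  \<open>\<epsilon> = sgn A\<close>, which multiplies the modulus by \<open>sgn A\<close>.\<close>

lemma elastic_curve_of_proportional_curvature:
  assumes gen: "generatrix I x z" and rel: "curvature_relation \<mu> I x z" and "\<mu> \<noteq> 0"
    and const: "\<forall>s\<in>I. ((\<lambda>s. curvature x z s / x s) has_real_derivative 0) (at s)"
  shows "\<exists>k. k \<noteq> 0 \<and> elastic_curve k I x z"
proof -
  have arc: "arclength_curve I x z" and pos: "\<And>s. s \<in> I \<Longrightarrow> x s > 0"
    and I: "is_interval I" and "I \<noteq> {}"
    using gen unfolding generatrix_def arclength_curve_def by auto
  note D = arclength_curve_derivs[OF arc]
  obtain C where "\<And>s. s \<in> I \<Longrightarrow> curvature x z s / x s = C"
    using constant_on_interval[OF I] const by blast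
  then have \<kappa>: "curvature x z s = 2 * (C / 2) * x s" if "s \<in> I" for s
    using pos[OF that] that by (fastforce simp: field_simps)
  define A where "A = C / 2"
  have "((\<lambda>s. A * (x s)\<^sup>2 - deriv z s) has_real_derivative 0) (at s)" if "s \<in> I" for s
    using D(1,4)[OF that] \<kappa>[OF that] frenet_equations(2)[OF arc that]
    by (auto intro!: derivative_eq_intros simp: A_def)
  then obtain m where m: "\<And>s. s \<in> I \<Longrightarrow> A * (x s)\<^sup>2 - deriv z s = m"
    using constant_on_interval[OF I] by blast
  have "\<mu> = - 4 * A * m"
  proof -
    obtain s where s: "s \<in> I"
      using \<open>I \<noteq> {}\<close> by auto
    have "x s * (\<mu> + 4 * A * m) = 0"
      using curvature_relation_cleared[OF gen rel s] \<kappa>[OF s] m[OF s]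
      unfolding A_def[symmetric] by algebra
    then show ?thesis
      using pos[OF s] by simp
  qed
  then have "A \<noteq> 0" "m \<noteq> 0"
    using \<open>\<mu> \<noteq> 0\<close> by auto
  have "\<bar>A\<bar> > 0" "sgn A \<in> {1, -1}" "sgn A * A = \<bar>A\<bar>"
    using \<open>A \<noteq> 0\<close> by (auto simp: sgn_real_def)
  moreover have "sgn A * curvature x z s = 2 * \<bar>A\<bar> * x s \<and>
      sgn A * deriv z s = \<bar>A\<bar> * (x s)\<^sup>2 - sgn A * m" if "s \<in> I" for s
    using \<kappa>[OF that] m[OF that] \<open>sgn A * A = \<bar>A\<bar>\<close> unfolding A_def[symmetric] by algebra
  ultimately have "elastic_curve (sgn A * m) I x z"
    using arc pos \<open>I \<noteq> {}\<close> unfolding elastic_curve_def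
    by (metis (no_types, lifting) all_not_in_conv less_irrefl)
  then show ?thesis
    using \<open>A \<noteq> 0\<close> \<open>m \<noteq> 0\<close> by (intro exI[of _ "sgn A * m"]) (simp add: sgn_zero_iff)
qed

lemma rot_surface_translate:
  "(\<lambda>p. p + vector [0, 0, c]) ` rot_surface I x z = rot_surface I x (\<lambda>s. z s + c)"
proof -
  have "rot_param x z s \<theta> + vector [0, 0, c] = rot_param x (\<lambda>s. z s + c) s \<theta>" for s \<theta>
    by (simp add: rot_param_def vec_eq_iff forall_3)
  then show ?thesis
    unfolding rot_surface_def by (auto simp: image_iff) metis+
qed

lemma dist_axis_point:
  fixes p :: "real^3"
  shows "(dist (vector [0, 0, c]) p)\<^sup>2 = (p $ 1)\<^sup>2 + (p $ 2)\<^sup>2 + (p $ 3 - c)\<^sup>2"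
  unfolding dist_norm power2_norm_eq_inner
  by (simp add: inner_vec_def sum_3 power2_eq_square algebra_simps)

lemma mem_sphere_axis:
  fixes p :: "real^3"
  assumes "R > 0"
  shows "p \<in> sphere (vector [0, 0, c]) R \<longleftrightarrow> (p $ 1)\<^sup>2 + (p $ 2)\<^sup>2 + (p $ 3 - c)\<^sup>2 = R\<^sup>2"
  using dist_axis_point[of c p] assms
  by (metis less_eq_real_def mem_sphere power2_eq_iff_nonneg zero_le_dist)

lemma rot_param_parallel:
  "(rot_param x z s \<theta> $ 1)\<^sup>2 + (rot_param x z s \<theta> $ 2)\<^sup>2 = (x s)\<^sup>2"
proof -
  have "(x s * cos \<theta>)\<^sup>2 + (x s * sin \<theta>)\<^sup>2 = (x s)\<^sup>2 * ((cos \<theta>)\<^sup>2 + (sin \<theta>)\<^sup>2)"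
    by algebra
  then show ?thesis
    by (simp add: rot_param_def)
qed

lemma mem_rot_surface:
  fixes p :: "real^3"
  assumes "s \<in> I" "x s > 0" "(p $ 1)\<^sup>2 + (p $ 2)\<^sup>2 = (x s)\<^sup>2" "p $ 3 = z s"
  shows "p \<in> rot_surface I x z"
proof -
  have "(p $ 1 / x s)\<^sup>2 + (p $ 2 / x s)\<^sup>2 = 1"
    using assms(2,3) by (simp add: power_divide flip: add_divide_distrib)
  then obtain \<theta> where "p $ 1 / x s = cos \<theta>" "p $ 2 / x s = sin \<theta>"
    using sincos_total_2pi by metis
  then have "p = rot_param x z s \<theta>"
    using assms(2,4) by (auto simp: rot_param_def vec_eq_iff forall_3 field_simps)
  then show ?thesis
    using assms(1) unfolding rot_surface_def by blast
qed

lemma rot_surface_subset_sphere_iff: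
  assumes "R > 0"
  shows "rot_surface I x z \<subseteq> sphere (vector [0, 0, c]) R \<longleftrightarrow>
    (\<forall>s\<in>I. (x s)\<^sup>2 + (z s - c)\<^sup>2 = R\<^sup>2)"
proof -
  have "rot_param x z s \<theta> \<in> sphere (vector [0, 0, c]) R \<longleftrightarrow> (x s)\<^sup>2 + (z s - c)\<^sup>2 = R\<^sup>2" for s \<theta>
    unfolding mem_sphere_axis[OF assms] rot_param_parallel by (simp add: rot_param_def)
  then show ?thesis
    unfolding rot_surface_def by blast
qed

text \<open>The surface is the preimage, within the sphere, of \<open>z ` I\<close> under the height function: a point
  of the sphere is determined up to rotation by its height. And \<open>z ` I\<close> is open because \<open>z\<close> is
  continuous and injective on an open interval.\<close>

lemma open_piece_sphere_of_monotone_height: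
  assumes "R > 0" "open I" "connected I" "I \<noteq> {}"
    and pos: "\<And>s. s \<in> I \<Longrightarrow> x s > 0"
    and circle: "\<And>s. s \<in> I \<Longrightarrow> (x s)\<^sup>2 + (z s)\<^sup>2 = R\<^sup>2"
    and cont: "continuous_on I z" and inj: "inj_on z I"
  shows "open_piece (rot_surface I x z) (sphere 0 R)"
proof -
  have zero: "(0 :: real^3) = vector [0, 0, 0]"
    by (simp add: vec_eq_iff forall_3)
  have "open (z ` I)"
    using injective_eq_1d_open_map_UNIV[of I z] assms(2,3) cont inj
    by (metis is_interval_connected_1 subset_UNIV order_refl)
  have "rot_surface I x z = sphere 0 R \<inter> (\<lambda>p. p $ 3) -` (z ` I)"
  proof
    show "rot_surface I x z \<subseteq> sphere 0 R \<inter> (\<lambda>p. p $ 3) -` (z ` I)"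
      using rot_surface_subset_sphere_iff[of R I x z 0] \<open>R > 0\<close> circle
      unfolding zero by (auto simp: rot_surface_def rot_param_def)
    show "sphere 0 R \<inter> (\<lambda>p. p $ 3) -` (z ` I) \<subseteq> rot_surface I x z"
    proof
      fix p :: "real^3"
      assume p: "p \<in> sphere 0 R \<inter> (\<lambda>p. p $ 3) -` (z ` I)"
      then obtain s where s: "s \<in> I" "p $ 3 = z s"
        by auto
      have "(p $ 1)\<^sup>2 + (p $ 2)\<^sup>2 + (p $ 3)\<^sup>2 = R\<^sup>2"
        using p mem_sphere_axis[OF \<open>R > 0\<close>, of p 0] unfolding zero by simp
      then have "(p $ 1)\<^sup>2 + (p $ 2)\<^sup>2 = (x s)\<^sup>2"
        using circle[OF s(1)] s(2) by simp
      then show "p \<in> rot_surface I x z"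
        using mem_rot_surface[where x = x and z = z] s pos by blast
    qed
  qed
  moreover have "open ((\<lambda>p :: real^3. p $ 3) -` (z ` I))"
    using \<open>open (z ` I)\<close> by (intro open_vimage continuous_intros)
  ultimately have "openin (top_of_set (sphere 0 R)) (rot_surface I x z)"
    by (auto simp: openin_open)
  moreover have "rot_surface I x z \<noteq> {}"
    using \<open>I \<noteq> {}\<close> unfolding rot_surface_def by auto
  ultimately show ?thesis
    by (simp add: open_piece_def)
qed

text \<open>With constant curvature \<open>K\<close> the Frenet equation \<open>x'' = - K * z'\<close> integrates to
  \<open>x' = C - K * z\<close>, while \<open>z' = K * x\<close>. Unit speed then says that \<open>(x, z)\<close> has distance
  \<open>1 / \<bar>K\<bar>\<close> from the point of the axis at height \<open>C / K\<close>.\<close>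

lemma umbilic_surface_is_sphere_piece:
  assumes gen: "generatrix I x z" and rel: "curvature_relation \<mu> I x z" and "\<mu> \<noteq> 0"
    and umb: "\<forall>s\<in>I. x s * curvature x z s = deriv z s \<and>
            (curvature x z has_real_derivative 0) (at s)"
  shows "\<mu> > 0 \<and> (\<exists>c. open_piece ((\<lambda>p. p + vector [0, 0, c]) ` rot_surface I x z)
            (sphere 0 (1 / sqrt \<mu>)))"
proof -
  have arc: "arclength_curve I x z" and pos: "\<And>s. s \<in> I \<Longrightarrow> x s > 0"
    and I: "open I" "is_interval I" "I \<noteq> {}"
    using gen unfolding generatrix_def arclength_curve_def by auto
  note D = arclength_curve_derivs[OF arc]
  obtain K where \<kappa>: "\<And>s. s \<in> I \<Longrightarrow> curvature x z s = K"
    using constant_on_interval[OF I(2)] umb by blast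
  then have z': "deriv z s = K * x s" if "s \<in> I" for s
    using umb that by (metis mult.commute)
  have "\<mu> = K\<^sup>2"
  proof -
    obtain s where s: "s \<in> I"
      using I(3) by auto
    have "x s * (\<mu> - K\<^sup>2) = 0"
      using curvature_relation_cleared[OF gen rel s] \<kappa>[OF s] z'[OF s] by algebra
    then show ?thesis
      using pos[OF s] by simp
  qed
  then have "\<mu> > 0" "K \<noteq> 0"
    using \<open>\<mu> \<noteq> 0\<close> by auto
  have "((\<lambda>s. deriv x s + K * z s) has_real_derivative 0) (at s)" if "s \<in> I" for s
    using D(2,3)[OF that] \<kappa>[OF that] frenet_equations(1)[OF arc that]
    by (auto intro!: derivative_eq_intros)
  then obtain C where "\<And>s. s \<in> I \<Longrightarrow> deriv x s + K * z s = C"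
    using constant_on_interval[OF I(2)] by blast
  then have x': "deriv x s = - K * (z s + - C / K)" if "s \<in> I" for s
    using \<open>K \<noteq> 0\<close> that by (fastforce simp: distrib_left)
  have "open_piece (rot_surface I x (\<lambda>s. z s + - C / K)) (sphere 0 (1 / sqrt \<mu>))"
  proof (rule open_piece_sphere_of_monotone_height)
    show "(x s)\<^sup>2 + (z s + - C / K)\<^sup>2 = (1 / sqrt \<mu>)\<^sup>2" if "s \<in> I" for s
    proof -
      have "\<mu> * ((x s)\<^sup>2 + (z s + - C / K)\<^sup>2) = 1"
        using D(5)[OF that] x'[OF that] z'[OF that] \<open>\<mu> = K\<^sup>2\<close> by algebra
      then show ?thesis
        using \<open>\<mu> > 0\<close> by (simp add: power_divide eq_divide_eq mult.commute)
    qed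
    show "continuous_on I (\<lambda>s. z s + - C / K)"
      using D(2) DERIV_isCont by (intro continuous_intros continuous_at_imp_continuous_on) blast
    show "inj_on (\<lambda>s. z s + - C / K) I"
    proof (rule linorder_inj_onI')
      fix s t assume st: "s \<in> I" "t \<in> I" "s < t"
      then have sub: "u \<in> I" if "s \<le> u" "u \<le> t" for u
        using I(2) that by (meson mem_is_interval_1_I)
      obtain u where "s < u" "u < t" "z t - z s = (t - s) * deriv z u"
        using MVT2[OF st(3), of z "deriv z"] D(2) sub by blast
      moreover have "deriv z u \<noteq> 0"
        using z' sub pos \<open>K \<noteq> 0\<close> calculation by (simp add: less_imp_neq[symmetric])
      ultimately show "z s + - C / K \<noteq> z t + - C / K"
        using st(3) by auto
    qed
  qed (use I \<open>\<mu> > 0\<close> pos in \<open>auto simp: is_interval_connected_1\<close>)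
  then show ?thesis
    using \<open>\<mu> > 0\<close> unfolding rot_surface_translate by blast
qed

section \<open>Spheres and elasticoids satisfy the relation\<close>

text \<open>The family is chosen to be closed under differentiation, so that induction on the order of
  the derivative goes through.\<close>

lemma smooth_on_sinusoid:
  "smooth_on I (\<lambda>s. a * cos (b * s) + d * sin (b * s) + e)"
proof -
  have deriv: "deriv (\<lambda>s. a * cos (b * s) + d * sin (b * s) + e)
      = (\<lambda>s. (d * b) * cos (b * s) + (- a * b) * sin (b * s) + 0)" for a d e
    by (intro ext DERIV_imp_deriv) (auto intro!: derivative_eq_intros)
  have "\<exists>a' d' e'. (deriv ^^ n) (\<lambda>s. a * cos (b * s) + d * sin (b * s) + e)
      = (\<lambda>s. a' * cos (b * s) + d' * sin (b * s) + e')" for n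
  proof (induction n)
    case (Suc n)
    then obtain a' d' e' where "(deriv ^^ n) (\<lambda>s. a * cos (b * s) + d * sin (b * s) + e)
        = (\<lambda>s. a' * cos (b * s) + d' * sin (b * s) + e')"
      by blast
    then have "(deriv ^^ Suc n) (\<lambda>s. a * cos (b * s) + d * sin (b * s) + e)
        = (\<lambda>s. (d' * b) * cos (b * s) + (- a' * b) * sin (b * s) + 0)"
      by (simp only: funpow.simps comp_apply deriv)
    then show ?case
      by blast
  qed (simp, blast)
  moreover have "(\<lambda>s. a' * cos (b * s) + d' * sin (b * s) + e') differentiable_on I"
    for a' d' e'
    by (intro differentiable_at_imp_differentiable_on)
      (auto simp: real_differentiable_def intro!: exI derivative_eq_intros)
  ultimately show ?thesis
    unfolding smooth_on_def by metis
qed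

lemma sphere_minus_axis_is_rotational:
  assumes "R > 0"
  shows "\<exists>I x z. generatrix I x z \<and> rot_surface I x z = sphere (vector [0, 0, c]) R - z_axis"
proof -
  define x where "x s = R * cos (s / R)" for s
  define z where "z s = R * sin (s / R) + c" for s
  define I where "I = {- (R * pi / 2) <..< R * pi / 2}"
  have x': "deriv x s = - sin (s / R)" and z': "deriv z s = cos (s / R)" for s
    unfolding x_def z_def using assms
    by (auto intro!: DERIV_imp_deriv derivative_eq_intros)
  have pos: "x s > 0" if "s \<in> I" for s
    using that assms unfolding x_def I_def
    by (intro mult_pos_pos cos_gt_zero_pi) (auto simp: field_simps)
  have "smooth_on I x" "smooth_on I z"
    using smooth_on_sinusoid[of I R "1 / R" 0 0] smooth_on_sinusoid[of I 0 "1 / R" R c]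
    by (simp_all add: x_def[abs_def] z_def[abs_def])
  then have gen: "generatrix I x z"
    using pos assms pi_gt_zero unfolding generatrix_def arclength_curve_def
    by (auto simp: I_def x' z' is_interval_oo mult_le_0_iff simp del: pi_gt_zero)
  have "rot_surface I x z \<subseteq> sphere (vector [0, 0, c]) R"
    unfolding rot_surface_subset_sphere_iff[OF assms]
    by (simp add: x_def z_def power_mult_distrib flip: distrib_left)
  moreover have "p \<notin> z_axis" if "p \<in> rot_surface I x z" for p
  proof
    assume "p \<in> z_axis"
    then have "p $ 1 = 0" "p $ 2 = 0"
      by (auto simp: z_axis_def)
    then show False
      using that rot_param_parallel[of x z] pos unfolding rot_surface_def
      by (smt (verit, best) mem_Collect_eq power_zero_numeral zero_eq_power2)
  qed
  moreover have "p \<in> rot_surface I x z" if p: "p \<in> sphere (vector [0, 0, c]) R" "p \<notin> z_axis" for p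
  proof -
    define h where "h = (p $ 3 - c) / R"
    have eq: "(p $ 1)\<^sup>2 + (p $ 2)\<^sup>2 + (p $ 3 - c)\<^sup>2 = R\<^sup>2"
      using p(1) mem_sphere_axis[OF assms] by blast
    have "(p $ 1)\<^sup>2 + (p $ 2)\<^sup>2 \<noteq> 0"
    proof
      assume "(p $ 1)\<^sup>2 + (p $ 2)\<^sup>2 = 0"
      then have "p = vector [0, 0, p $ 3]"
        by (simp add: vec_eq_iff forall_3 sum_power2_eq_zero_iff)
      then show False
        using p(2) unfolding z_axis_def by blast
    qed
    then have "(p $ 1)\<^sup>2 + (p $ 2)\<^sup>2 > 0"
      by (metis sum_power2_gt_zero_iff sum_power2_eq_zero_iff)
    then have "(p $ 3 - c)\<^sup>2 < R\<^sup>2"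
      using eq by linarith
    then have "\<bar>h\<bar> < 1"
      using assms unfolding h_def abs_square_less_1[symmetric] by (simp add: power_divide)
    then have h: "- 1 < h" "h < 1"
      by auto
    define s where "s = R * arcsin h"
    have "sin (s / R) = h"
      using h assms by (simp add: s_def)
    have "s \<in> I"
      using mult_strict_left_mono[OF _ assms, of "- (pi / 2)" "arcsin h"]
        mult_strict_left_mono[OF _ assms, of "arcsin h" "pi / 2"] arcsin_lt_bounded[OF h]
      unfolding I_def s_def by simp
    moreover have "p $ 3 = z s"
      using \<open>sin (s / R) = h\<close> assms by (simp add: z_def h_def)
    moreover have "(p $ 1)\<^sup>2 + (p $ 2)\<^sup>2 = (x s)\<^sup>2"
    proof -
      have "(x s)\<^sup>2 + (z s - c)\<^sup>2 = R\<^sup>2"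
        by (simp add: x_def z_def power_mult_distrib flip: distrib_left)
      then show ?thesis
        using eq \<open>p $ 3 = z s\<close> by simp
    qed
    ultimately show ?thesis
      using mem_rot_surface[where x = x and z = z] pos by blast
  qed
  ultimately show ?thesis
    using gen by blast
qed

text \<open>Let \<open>N = x * z' - (z - c) * x'\<close> be the cross product of the position relative to the centre
  with the unit tangent. As these two vectors are orthogonal, \<open>N\<close> is \<open>R\<close> or \<open>- R\<close> according to the
  orientation, and both principal curvatures equal \<open>1 / N\<close>.\<close>

lemma curvature_relation_of_sphere:
  assumes "R > 0" and gen: "generatrix I x z"
    and sub: "rot_surface I x z \<subseteq> sphere (vector [0, 0, c]) R"
  shows "curvature_relation (1 / R\<^sup>2) I x z"
  unfolding curvature_relation_def
proof (intro ballI impI)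
  fix s assume s: "s \<in> I" "x s \<noteq> 0"
  have arc: "arclength_curve I x z" and "open I"
    using gen unfolding generatrix_def arclength_curve_def by auto
  note D = arclength_curve_derivs[OF arc]
  have circle: "(x t)\<^sup>2 + (z t - c)\<^sup>2 - R\<^sup>2 = 0" if "t \<in> I" for t
    using sub that unfolding rot_surface_subset_sphere_iff[OF \<open>R > 0\<close>] by simp
  have tangent: "x t * deriv x t + (z t - c) * deriv z t = 0" if "t \<in> I" for t
  proof -
    have "((\<lambda>t. (x t)\<^sup>2 + (z t - c)\<^sup>2 - R\<^sup>2) has_real_derivative
        2 * (x t * deriv x t + (z t - c) * deriv z t)) (at t)"
      using D(1,2)[OF that] by (auto intro!: derivative_eq_intros)
    then show ?thesis
      using derivative_zero_on_open[OF _ \<open>open I\<close> that circle] by fastforce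
  qed
  have "((\<lambda>t. x t * deriv x t + (z t - c) * deriv z t) has_real_derivative
      deriv x s * deriv x s + x s * deriv (deriv x) s
        + (deriv z s * deriv z s + (z s - c) * deriv (deriv z) s)) (at s)"
    using D(1-4)[OF s(1)] by (auto intro!: derivative_eq_intros)
  then have second: "deriv x s * deriv x s + x s * deriv (deriv x) s
        + (deriv z s * deriv z s + (z s - c) * deriv (deriv z) s) = 0"
    by (rule derivative_zero_on_open[OF _ \<open>open I\<close> s(1) tangent])
  define N where "N = x s * deriv z s - (z s - c) * deriv x s"
  have "curvature x z s * N = 1"
    using second frenet_equations[OF arc s(1)] D(5)[OF s(1)] unfolding N_def by algebra
  moreover have "N\<^sup>2 = R\<^sup>2"
    using circle[OF s(1)] tangent[OF s(1)] D(5)[OF s(1)] unfolding N_def by algebra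
  moreover have "x s * N = N\<^sup>2 * deriv z s"
    using circle[OF s(1)] tangent[OF s(1)] \<open>N\<^sup>2 = R\<^sup>2\<close> unfolding N_def by algebra
  moreover have "N \<noteq> 0"
    using calculation(1) by auto
  ultimately have "N * (x s) = N * (N * deriv z s)"
    by (simp add: power2_eq_square mult.commute mult.left_commute)
  then have "x s = N * deriv z s"
    using \<open>N \<noteq> 0\<close> by simp
  then have "curvature x z s = 1 / N" "deriv z s / x s = 1 / N" "1 / R\<^sup>2 = 1 / N\<^sup>2"
    using s(2) \<open>curvature x z s * N = 1\<close> \<open>N\<^sup>2 = R\<^sup>2\<close> \<open>N \<noteq> 0\<close> by (simp_all add: eq_divide_eq)
  then show "(meridian_curvature x z s)\<^sup>2 - 2 * parallel_curvature x z s * meridian_curvature x z s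
      + 1 / R\<^sup>2 = 0"
    unfolding meridian_curvature_def parallel_curvature_def
    by (simp add: power2_eq_square)
qed

text \<open>Both \<open>\<kappa>\<^sup>2 = 4 * a\<^sup>2 * x\<^sup>2\<close> and \<open>2 * k\<^sub>p * \<kappa> = 4 * a * (a * x\<^sup>2 - k)\<close> are
  independent of \<open>\<epsilon>\<close>, and their difference is the constant \<open>4 * a * k\<close>.\<close>

lemma curvature_relation_of_elastic_curve:
  assumes "k \<noteq> 0" "elastic_curve k I x z"
  shows "\<exists>\<mu>. \<mu> \<noteq> 0 \<and> curvature_relation \<mu> I x z"
proof -
  obtain a \<epsilon> where "a > 0" "\<epsilon> \<in> {1, -1 :: real}"
    and elastic: "\<And>s. s \<in> I \<Longrightarrow> \<epsilon> * curvature x z s = 2 * a * x s"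
      "\<And>s. s \<in> I \<Longrightarrow> \<epsilon> * deriv z s = a * (x s)\<^sup>2 - k"
    using assms(2) unfolding elastic_curve_def by blast
  have "\<epsilon>\<^sup>2 = 1"
    using \<open>\<epsilon> \<in> {1, -1}\<close> by auto
  have "(curvature x z s)\<^sup>2 - 2 * (deriv z s / x s) * curvature x z s + - 4 * a * k = 0"
    if "s \<in> I" "x s \<noteq> 0" for s
  proof -
    define w where "w = deriv z s / x s"
    have "x s * w = deriv z s"
      using that(2) by (simp add: w_def)
    have \<kappa>: "curvature x z s = \<epsilon> * (2 * a * x s)"
      using elastic(1)[OF that(1)] \<open>\<epsilon>\<^sup>2 = 1\<close> by algebra
    have "(curvature x z s)\<^sup>2 = 4 * a * (a * (x s)\<^sup>2)"
      unfolding \<kappa> using \<open>\<epsilon>\<^sup>2 = 1\<close> by (simp add: power_mult_distrib power2_eq_square[of a])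
    moreover have "2 * w * curvature x z s = 4 * a * (\<epsilon> * (x s * w))"
      unfolding \<kappa> by (simp add: algebra_simps)
    then have "2 * w * curvature x z s = 4 * a * (a * (x s)\<^sup>2 - k)"
      using elastic(2)[OF that(1)] \<open>x s * w = deriv z s\<close> by simp
    ultimately show ?thesis
      unfolding w_def[symmetric] by (simp only: right_diff_distrib mult.assoc mult_minus_left)
  qed
  then have "curvature_relation (- 4 * a * k) I x z"
    unfolding curvature_relation_def meridian_curvature_def parallel_curvature_def by blast
  then show ?thesis
    using \<open>a > 0\<close> \<open>k \<noteq> 0\<close> by (intro exI[of _ "- 4 * a * k"]) simp
qed

section \<open>The classification\<close>

theorem theorem3p6:
  shows
    "(\<forall>\<mu> I x z. \<mu> \<noteq> 0 \<and> generatrix I x z \<and> curvature_relation \<mu> I x z \<longrightarrow>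
        (\<exists>c. let S = (\<lambda>p. p + vector [0, 0, c]) ` rot_surface I x z in
           (\<mu> > 0 \<and> open_piece S (sphere 0 (1 / sqrt \<mu>))) \<or>
           (\<exists>k E. k \<noteq> 0 \<and> elasticoid k E \<and> open_piece S E)))
     \<and>
     (\<forall>\<mu> c. \<mu> > 0 \<longrightarrow>
        (\<exists>I x z. generatrix I x z \<and>
           rot_surface I x z = sphere (vector [0, 0, c]) (1 / sqrt \<mu>) - z_axis) \<and>
        (\<forall>I x z. generatrix I x z \<and>
           rot_surface I x z \<subseteq> sphere (vector [0, 0, c]) (1 / sqrt \<mu>) \<longrightarrow>
           curvature_relation \<mu> I x z))
     \<and>
     (\<forall>k I x z. k \<noteq> 0 \<and> elastic_curve k I x z \<longrightarrow>
        (\<exists>\<mu>. \<mu> \<noteq> 0 \<and> curvature_relation \<mu> I x z))"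
proof (intro conjI allI impI)
  fix \<mu> :: real and I x z
  assume h: "\<mu> \<noteq> 0 \<and> generatrix I x z \<and> curvature_relation \<mu> I x z"
  then have "\<mu> \<noteq> 0" and gen: "generatrix I x z" and rel: "curvature_relation \<mu> I x z"
    by auto
  from umbilic_or_curvature_proportional[OF gen rel \<open>\<mu> \<noteq> 0\<close>]
  show "\<exists>c. let S = (\<lambda>p. p + vector [0, 0, c]) ` rot_surface I x z in
           (\<mu> > 0 \<and> open_piece S (sphere 0 (1 / sqrt \<mu>))) \<or>
           (\<exists>k E. k \<noteq> 0 \<and> elasticoid k E \<and> open_piece S E)"
  proof
    assume "\<forall>s\<in>I. x s * curvature x z s = deriv z s \<and>
            (curvature x z has_real_derivative 0) (at s)"
    then show ?thesis
      using umbilic_surface_is_sphere_piece[OF gen rel \<open>\<mu> \<noteq> 0\<close>] unfolding Let_def by blast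
  next
    assume "\<forall>s\<in>I. ((\<lambda>s. curvature x z s / x s) has_real_derivative 0) (at s)"
    then obtain k where "k \<noteq> 0" "elastic_curve k I x z"
      using elastic_curve_of_proportional_curvature[OF gen rel \<open>\<mu> \<noteq> 0\<close>] by blast
    then have "elasticoid k (rot_surface I x z)"
      unfolding elasticoid_def by blast
    moreover have "open_piece (rot_surface I x z) (rot_surface I x z)"
      using gen unfolding open_piece_def generatrix_def arclength_curve_def rot_surface_def
      by fastforce
    moreover have "(\<lambda>p. p + vector [0, 0, 0]) ` rot_surface I x z = rot_surface I x z"
      by (simp add: rot_surface_translate)
    ultimately show ?thesis
      using \<open>k \<noteq> 0\<close> unfolding Let_def by metis
  qed
next
  fix \<mu> c :: real
  assume "\<mu> > 0"
  then show "\<exists>I x z. generatrix I x z \<and>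
      rot_surface I x z = sphere (vector [0, 0, c]) (1 / sqrt \<mu>) - z_axis"
    by (intro sphere_minus_axis_is_rotational) simp
next
  fix \<mu> c :: real and I x z
  assume "\<mu> > 0" "generatrix I x z \<and>
      rot_surface I x z \<subseteq> sphere (vector [0, 0, c]) (1 / sqrt \<mu>)"
  then have "curvature_relation (1 / (1 / sqrt \<mu>)\<^sup>2) I x z"
    by (intro curvature_relation_of_sphere) auto
  then show "curvature_relation \<mu> I x z"
    using \<open>\<mu> > 0\<close> by (simp add: power_divide)
next
  fix k I x z
  assume "k \<noteq> 0 \<and> elastic_curve k I x z"
  then show "\<exists>\<mu>. \<mu> \<noteq> 0 \<and> curvature_relation \<mu> I x z"
    using curvature_relation_of_elastic_curve by blast
qed

end
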